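(* Let $\delta\in\mathbb{N}$ ($\delta\ge1$), $(a_0,\ldots,a_{\delta-1})\in\mathbb{R}^\delta$ and $b\in\mathbb{R}$, and let $(\alpha_n)_{n\in\mathbb{N}_0}$ be the real sequence with given seeds $(\alpha_0,\ldots,\alpha_{\delta-1})\in\mathbb{R}^\delta$ satisfying, for all $n\in\mathbb{N}_0$, $$\alpha_{n+\delta}=b+\sum_{\nu=0}^{\delta-1}a_\nu\alpha_{n+\nu}.$$ Let $(t_n)_{n\in\mathbb{N}_0}$ satisfy $t_0\in\mathbb{R}$ and $t_{n+1}=2t_n+\alpha_n$ for all $n\in\mathbb{N}_0$. Then for $0\le n\le\delta$, $$t_n=2^nt_0+\sum_{\nu=0}^{n-1}2^{n-1-\nu}\alpha_\nu,$$ and for all $n\in\mathbb{N}_0$, $$t_{n+\delta+1}=b+\sum_{\nu=0}^{\delta}\tau_\nu t_{n+\nu},$$ where $\tau_\nu=a_{\nu-1}-2a_\nu$ for $0\le\nu\le\delta$, with the conventions $a_{-1}:=0$ and $a_\delta:=-1$.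
   Context: $\mathbb{N}_0$ denotes the nonnegative integers; an empty sum is zero. *)

theory Defs
  imports Complex_Main
begin

text \<open>
  A coefficient tuple of length \<open>d\<close> is given as a function \<open>a\<close> on the naturals of which only the
  values below \<open>d\<close> are used; \<open>coeff_ext d a\<close> extends it to the indices \<open>-1, ..., d\<close>.
  Its values at other indices are irrelevant.
\<close>

definition coeff_ext :: "nat \<Rightarrow> (nat \<Rightarrow> real) \<Rightarrow> int \<Rightarrow> real" where
  "coeff_ext d a i = (if i = -1 then 0 else if i = int d then -1 else a (nat i))"

definition tau :: "nat \<Rightarrow> (nat \<Rightarrow> real) \<Rightarrow> nat \<Rightarrow> real" where
  "tau d a \<nu> = coeff_ext d a (int \<nu> - 1) - 2 * coeff_ext d a (int \<nu>)"

end

theory Submission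
  imports Defs
begin

text \<open>
  Write \<open>E\<close> for the shift of sequences. The hypothesis on \<open>t\<close> says \<open>(E - 2) t = \<alpha>\<close>, and the one on
  \<open>\<alpha>\<close> says \<open>p(E) \<alpha> = b\<close> with \<open>p(x) = x\<^sup>\<delta> - (\<Sum>\<nu><\<delta>. a \<nu> * x\<^sup>\<nu>)\<close>; hence \<open>p(E) (E - 2) t = b\<close>.
  The conventions \<open>a\<^sub>-\<^sub>1 = 0\<close> and \<open>a\<^sub>\<delta> = -1\<close> are made so that \<open>\<tau>\<^sub>\<nu>\<close> is minus the
  coefficient of \<open>x\<^sup>\<nu>\<close> in \<open>(x - 2) p(x)\<close> for \<open>\<nu> \<le> \<delta>\<close>; this product is carried out in \<open>sum_tau\<close>.
  The explicit formula for \<open>t\<close> comes from iterating \<open>t (Suc n) = 2 * t n + \<alpha> n\<close>: each \<open>\<alpha> \<nu>\<close>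
  enters in the step to \<open>t (Suc \<nu>)\<close> and is doubled in each later one.
\<close>

text \<open>
  Summation by parts: the part \<open>a\<^sub>\<nu>\<^sub>-\<^sub>1\<close> of \<open>\<tau>\<^sub>\<nu>\<close> is moved from \<open>u \<nu>\<close> to the next index down, where it
  combines with \<open>-2 a\<^sub>\<nu>\<close> to the operator \<open>E - 2\<close> applied to \<open>u\<close>. The convention \<open>a\<^sub>-\<^sub>1 = 0\<close> removes the
  boundary term at the bottom, and \<open>a\<^sub>d = -1\<close> leaves \<open>2 * u d\<close> at the top.
\<close>

lemma sum_tau:
  fixes u :: "nat \<Rightarrow> real"
  shows "(\<Sum>\<nu>\<le>d. tau d a \<nu> * u \<nu>) = 2 * u d + (\<Sum>\<nu><d. a \<nu> * (u (Suc \<nu>) - 2 * u \<nu>))"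
proof -
  let ?c = "coeff_ext d a"
  have inner: "?c (int \<nu>) = a \<nu>" if "\<nu> < d" for \<nu>
    using that by (simp add: coeff_ext_def)
  have bottom: "?c (-1) = 0" and top: "?c (int d) = -1"
    by (simp_all add: coeff_ext_def)
  have shifted: "(\<Sum>\<nu><Suc d. ?c (int \<nu> - 1) * u \<nu>) = (\<Sum>\<nu><d. a \<nu> * u (Suc \<nu>))"
    unfolding sum.lessThan_Suc_shift by (simp add: bottom inner)
  have unshifted: "(\<Sum>\<nu><Suc d. ?c (int \<nu>) * u \<nu>) = (\<Sum>\<nu><d. a \<nu> * u \<nu>) - u d"
    by (simp add: top inner)
  have "(\<Sum>\<nu>\<le>d. tau d a \<nu> * u \<nu>) =
      (\<Sum>\<nu><Suc d. ?c (int \<nu> - 1) * u \<nu>) - 2 * (\<Sum>\<nu><Suc d. ?c (int \<nu>) * u \<nu>)"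
    unfolding lessThan_Suc_atMost sum_distrib_left sum_subtractf [symmetric]
    by (simp add: tau_def algebra_simps)
  also have "\<dots> = 2 * u d + (\<Sum>\<nu><d. a \<nu> * (u (Suc \<nu>) - 2 * u \<nu>))"
    unfolding shifted unshifted
    by (simp add: algebra_simps sum_subtractf sum_distrib_left)
  finally show ?thesis .
qed

lemma affine_recurrence_solution:
  fixes t \<alpha> :: "nat \<Rightarrow> 'a::comm_ring_1"
  assumes step: "\<And>n. t (Suc n) = c * t n + \<alpha> n"
  shows "t n = c ^ n * t 0 + (\<Sum>\<nu><n. c ^ (n - 1 - \<nu>) * \<alpha> \<nu>)"
proof (induction n)
  case 0
  show ?case by simp
next
  case (Suc n)
  have "c * (\<Sum>\<nu><n. c ^ (n - 1 - \<nu>) * \<alpha> \<nu>) = (\<Sum>\<nu><n. c ^ (n - \<nu>) * \<alpha> \<nu>)"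
    unfolding sum_distrib_left
  proof (rule sum.cong)
    fix \<nu> assume "\<nu> \<in> {..<n}"
    then have "n - \<nu> = Suc (n - 1 - \<nu>)" by auto
    then show "c * (c ^ (n - 1 - \<nu>) * \<alpha> \<nu>) = c ^ (n - \<nu>) * \<alpha> \<nu>"
      by (simp add: mult.assoc)
  qed simp
  then have "c * t n + \<alpha> n = c ^ Suc n * t 0 + (\<Sum>\<nu><Suc n. c ^ (Suc n - 1 - \<nu>) * \<alpha> \<nu>)"
    by (subst Suc.IH) (simp add: distrib_left mult.assoc)
  then show ?case by (simp only: step)
qed

theorem lemma4:
  fixes \<delta> :: nat and a :: "nat \<Rightarrow> real" and b :: real
    and \<alpha> t :: "nat \<Rightarrow> real"
  assumes "\<delta> \<ge> 1"
    and "\<And>n. \<alpha> (n + \<delta>) = b + (\<Sum>\<nu><\<delta>. a \<nu> * \<alpha> (n + \<nu>))"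
    and "\<And>n. t (Suc n) = 2 * t n + \<alpha> n"
  shows "(\<forall>n\<le>\<delta>. t n = 2 ^ n * t 0 + (\<Sum>\<nu><n. 2 ^ (n - 1 - \<nu>) * \<alpha> \<nu>)) \<and>
         (\<forall>n. t (n + \<delta> + 1) = b + (\<Sum>\<nu>\<le>\<delta>. tau \<delta> a \<nu> * t (n + \<nu>)))"
proof (intro conjI allI impI)
  fix n
  show "t n = 2 ^ n * t 0 + (\<Sum>\<nu><n. 2 ^ (n - 1 - \<nu>) * \<alpha> \<nu>)"
    using assms(3) by (rule affine_recurrence_solution)
next
  fix n
  have "(\<Sum>\<nu>\<le>\<delta>. tau \<delta> a \<nu> * t (n + \<nu>)) = 2 * t (n + \<delta>) + (\<Sum>\<nu><\<delta>. a \<nu> * \<alpha> (n + \<nu>))"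
    using sum_tau [of \<delta> a "\<lambda>\<nu>. t (n + \<nu>)"] by (simp add: assms(3))
  then show "t (n + \<delta> + 1) = b + (\<Sum>\<nu>\<le>\<delta>. tau \<delta> a \<nu> * t (n + \<nu>))"
    by (simp add: assms(2,3))
qed

end
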